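(* Every eigenvalue $\lambda\in\mathbb{C}$ of the operator $$\mathcal{D}u=\frac{1}{k_0^2}\,\frac{1}{S(y)}\,\frac{d}{dy}\Bigl(\frac{1}{S(y)}\,\frac{du}{dy}\Bigr)$$ defined on $H^2_{\mathrm{per}}(-L,L)$ satisfies $\operatorname{Im}(\lambda)\ge 0$.
   Context: Here $k_0>0$ is a real constant, $0<L^*<L$, and $H^2_{\mathrm{per}}(-L,L)$ is the Sobolev space of complex-valued $2L$-periodic $H^2$ functions on $[-L,L]$. The stretching function $S$ is $$S(y)=\begin{cases}1,&|y|<L^*,\\ 1+\mathrm{e}^{\mathrm{i}\vartheta}\sigma(|y|-L),&L^*\le|y|<L,\end{cases}$$ with a real constant $\vartheta\in(0,\pi/2)$ and a real-valued bounded measurable absorbing function $\sigma$, and it satisfies $\operatorname{Re}S(y)\ge1$ and $\operatorname{Im}S(y)\ge0$ for all $y$; $S$ is extended $2L$-periodically. A number $\lambda\in\mathbb{C}$ is an eigenvalue of $\mathcal{D}$ if there is a nonzero $u\in H^2_{\mathrm{per}}(-L,L)$ with $\mathcal{D}u=\lambda u$, where this means that the $2L$-periodic function $\frac{1}{S}u'$ has a (periodic) weak derivative in $L^2(-L,L)$ and $\frac{1}{k_0^2 S}\bigl(\frac1S u'\bigr)'=\lambda u$ almost everywhere. *)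

theory Defs
  imports "HOL-Analysis.Analysis" "HOL-Library.Periodic_Fun"
begin

text \<open>
  Functions on the torus of length \<open>2 L\<close> are represented by genuinely \<open>2 L\<close>-periodic functions
  on the real line; classes modulo null sets are not formed, so equality in
  \<open>L\<^sup>2(-L, L)\<close> is always written out as almost-everywhere equality on \<open>{-L..L}\<close>.
\<close>

definition L2_per :: "real \<Rightarrow> (real \<Rightarrow> complex) set" where
  "L2_per L = {f. periodic_fun_simple f (2 * L) \<and>
                  f \<in> borel_measurable (lebesgue_on {-L..L}) \<and>
                  integrable (lebesgue_on {-L..L}) (\<lambda>x. (cmod (f x))\<^sup>2)}"

definition smooth :: "(real \<Rightarrow> complex) \<Rightarrow> bool" where
  "smooth \<phi> \<longleftrightarrow>
     (\<forall>n x. ((\<lambda>g t. vector_derivative g (at t)) ^^ n) \<phi> differentiable (at x))"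

text \<open>
  \<open>g\<close> is the weak derivative of \<open>f\<close> on the torus. Testing against periodic functions, rather
  than functions with compact support in the open interval, forces the boundary values
  of \<open>f\<close> at \<open>-L\<close> and \<open>L\<close> to match.
\<close>

definition has_weak_deriv_per :: "real \<Rightarrow> (real \<Rightarrow> complex) \<Rightarrow> (real \<Rightarrow> complex) \<Rightarrow> bool" where
  "has_weak_deriv_per L f g \<longleftrightarrow>
     f \<in> L2_per L \<and> g \<in> L2_per L \<and>
     (\<forall>\<phi>. smooth \<phi> \<and> periodic_fun_simple \<phi> (2 * L) \<longrightarrow>
        (LINT x|lebesgue_on {-L..L}. f x * vector_derivative \<phi> (at x)) =
        - (LINT x|lebesgue_on {-L..L}. g x * \<phi> x))"

definition H2_per :: "real \<Rightarrow> (real \<Rightarrow> complex) set" where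
  "H2_per L = {u. \<exists>u' u''. has_weak_deriv_per L u u' \<and> has_weak_deriv_per L u' u''}"

text \<open>
  The formula fixes \<open>S\<close> only on the open interval \<open>(-L, L)\<close>; by periodicity only the values at
  the odd multiples of \<open>L\<close> remain free.
\<close>

definition is_stretching_function ::
    "real \<Rightarrow> real \<Rightarrow> real \<Rightarrow> (real \<Rightarrow> real) \<Rightarrow> (real \<Rightarrow> complex) \<Rightarrow> bool" where
  "is_stretching_function L Lstar \<theta> \<sigma> S \<longleftrightarrow>
     periodic_fun_simple S (2 * L) \<and>
     (\<forall>y. \<bar>y\<bar> < Lstar \<longrightarrow> S y = 1) \<and>
     (\<forall>y. Lstar \<le> \<bar>y\<bar> \<and> \<bar>y\<bar> < L \<longrightarrow>
        S y = 1 + exp (\<i> * of_real \<theta>) * of_real (\<sigma> (\<bar>y\<bar> - L)))"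

text \<open>
  \<open>\<D> u = v\<close> as a relation: \<open>\<D>\<close> need not be defined on all of \<open>H\<^sup>2\<close>, because the periodic
  function \<open>u' / S\<close> may fail to be weakly differentiable when \<open>S\<close> jumps.
\<close>

definition D_op :: "real \<Rightarrow> real \<Rightarrow> (real \<Rightarrow> complex) \<Rightarrow> (real \<Rightarrow> complex) \<Rightarrow> (real \<Rightarrow> complex) \<Rightarrow> bool" where
  "D_op k0 L S u v \<longleftrightarrow>
     (\<exists>u' w. has_weak_deriv_per L u u' \<and>
             has_weak_deriv_per L (\<lambda>y. 1 / S y * u' y) w \<and>
             (AE y in lebesgue_on {-L..L}. 1 / (of_real (k0\<^sup>2) * S y) * w y = v y))"

definition D_eigenvalue :: "real \<Rightarrow> real \<Rightarrow> (real \<Rightarrow> complex) \<Rightarrow> complex \<Rightarrow> bool" where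
  "D_eigenvalue k0 L S ev \<longleftrightarrow>
     (\<exists>u \<in> H2_per L. \<not> (AE y in lebesgue_on {-L..L}. u y = 0) \<and>
                     D_op k0 L S u (\<lambda>y. ev * u y))"

end

theory Submission
  imports Defs
begin

text \<open>
  Let \<open>u\<close> be an eigenfunction and let \<open>w\<close> be the weak derivative of \<open>u' / S\<close>, so that
  \<open>w = k0\<^sup>2 ev S u\<close> almost everywhere. Multiplying by \<open>cnj u\<close>, integrating over a period and
  integrating by parts yields the energy identity
  \<open>ev (k0\<^sup>2 \<integral> S |u|\<^sup>2) = - \<integral> |u'|\<^sup>2 / S\<close>.
  The values of \<open>S\<close> lie in the first quadrant with real part at least \<open>1\<close>, hence the integral on the
  left has positive real and nonnegative imaginary part, while \<open>1 / S\<close> and thus the integral on the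
  right lie in the fourth quadrant. So \<open>ev\<close> is a quotient of a number in the second quadrant by one in the
  first, and its imaginary part is nonnegative (\<open>Im_ratio_nonneg\<close>).

  The analytic content is the integration by parts (\<open>energy_identity\<close>), since weak derivatives are
  defined by smooth periodic test functions and \<open>cnj u\<close> is not smooth. It is obtained by showing
  that a function with weak derivative \<open>g\<close> is almost everywhere a constant plus the indefinite
  integral of \<open>g\<close>, where \<open>g\<close> has mean zero (\<open>has_weak_deriv_imp_primitive\<close>). For such
  functions integration by parts is Fubini's theorem on a square cut along its diagonal
  (\<open>product_rule_primitive\<close>, \<open>integration_by_parts_periodic\<close>).

  To identify the function with the primitive, it suffices to test with the harmonics, which are
  smooth and whose derivatives are explicit: the difference of the two has vanishing Fourier
  coefficients at all nonzero frequencies. An integrable function all of whose Fourier coefficients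
  vanish is zero almost everywhere (\<open>zero_fourier_coeffs_imp_AE_0\<close>): by Stone--Weierstrass on the
  unit circle it is orthogonal to the continuous functions, then to indicators of compact sets, and
  hence has integral zero over every measurable set.
\<close>

section \<open>Harmonics of a period\<close>

abbreviation period_measure :: "real \<Rightarrow> real measure" where
  "period_measure L \<equiv> lebesgue_on {-L..L}"

definition harmonic :: "real \<Rightarrow> int \<Rightarrow> real \<Rightarrow> complex" where
  "harmonic L n x = cis (pi * of_int n * x / L)"

lemma harmonic_0 [simp]: "harmonic L 0 x = 1"
  by (simp add: harmonic_def)

lemma norm_harmonic [simp]: "norm (harmonic L n x) = 1"
  by (simp add: harmonic_def)

lemma harmonic_add: "harmonic L (m + n) x = harmonic L m x * harmonic L n x"
  by (simp add: harmonic_def cis_mult ring_distribs add_divide_distrib)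

lemma harmonic_has_vector_derivative:
  "(harmonic L n has_vector_derivative (\<i> * of_real (pi * of_int n / L)) * harmonic L n x) (at x within A)"
proof (cases "L = 0")
  case False
  then show ?thesis
    unfolding harmonic_def cis_conv_exp
    by (auto intro!: derivative_eq_intros has_vector_derivative_real_field simp: field_simps)
qed (simp add: harmonic_def [abs_def])

lemma continuous_on_harmonic [continuous_intros]: "continuous_on A (harmonic L n)"
  unfolding continuous_on_eq_continuous_within
  by (intro ballI has_vector_derivative_continuous [OF harmonic_has_vector_derivative])

lemma smooth_harmonic: "smooth (harmonic L n)"
proof -
  define c where "c = \<i> * of_real (pi * of_int n / L)"
  have der: "((\<lambda>t. a * harmonic L n t) has_vector_derivative a * (c * harmonic L n x)) (at x)" for a x
    unfolding c_def
    by (intro has_vector_derivative_mult_right harmonic_has_vector_derivative)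
  have "((\<lambda>g t. vector_derivative g (at t)) ^^ k) (harmonic L n) = (\<lambda>t. c ^ k * harmonic L n t)" for k
    by (induction k) (auto simp: vector_derivative_at [OF der] algebra_simps)
  then show ?thesis
    unfolding smooth_def using differentiableI_vector [OF der] by (simp only:) blast
qed

lemma periodic_harmonic:
  assumes "L \<noteq> 0"
  shows "periodic_fun_simple (harmonic L n) (2 * L)"
proof
  have "cis (2 * pi * of_int n) = 1" 
    by (rule cis_multiple_2pi) auto
  moreover have "pi * of_int n * (x + 2 * L) / L = pi * of_int n * x / L + 2 * pi * of_int n" for x
    using assms by (simp add: field_simps)
  ultimately show "harmonic L n (x + 2 * L) = harmonic L n x" for x
    by (simp only: harmonic_def cis_mult [symmetric] mult_1_right)
qed

lemma continuous_integrable_interval: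
  fixes f :: "real \<Rightarrow> complex"
  assumes "continuous_on {a..b} f"
  shows "integrable (lebesgue_on {a..b}) f"
  using absolutely_integrable_continuous_real [OF assms]
  by (simp add: absolutely_integrable_on_def integrable_restrict_space set_integrable_def)

lemma finite_measure_period: "finite_measure (period_measure L)"
  by (rule finite_measure_lebesgue_on) auto

lemma integrable_mult_bounded:
  fixes f g :: "'a \<Rightarrow> complex"
  assumes f: "integrable M f" and g [measurable]: "g \<in> borel_measurable M"
    and bd: "\<And>x. x \<in> space M \<Longrightarrow> norm (g x) \<le> C"
  shows "integrable M (\<lambda>x. f x * g x)"
proof (rule Bochner_Integration.integrable_bound)
  have [measurable]: "f \<in> borel_measurable M" using f by auto
  show "(\<lambda>x. f x * g x) \<in> borel_measurable M" by measurable
  show "integrable M (\<lambda>x. C * norm (f x))" using f by auto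
  show "AE x in M. norm (f x * g x) \<le> norm (C * norm (f x))"
    using bd by (intro AE_I2) 
      (smt (verit, best) abs_mult abs_norm_cancel mult.commute mult_right_mono norm_ge_zero norm_mult real_norm_def)
qed

lemma harmonic_measurable: "harmonic L n \<in> borel_measurable (period_measure L)"
  by (intro continuous_imp_measurable_on_sets_lebesgue continuous_intros) auto

section \<open>Uniqueness of Fourier coefficients\<close>

definition zero_fourier_coeffs :: "real \<Rightarrow> (real \<Rightarrow> complex) \<Rightarrow> bool" where
  "zero_fourier_coeffs L h \<longleftrightarrow> integrable (period_measure L) h \<and>
     (\<forall>n. (LINT x|period_measure L. h x * harmonic L n x) = 0)"

lemma zero_fourier_coeffs_integrable: "zero_fourier_coeffs L h \<Longrightarrow> integrable (period_measure L) (\<lambda>x. h x * harmonic L n x)"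
  unfolding zero_fourier_coeffs_def
  by (intro integrable_mult_bounded [where C=1] harmonic_measurable) auto

lemma zero_fourier_coeffs_add:
  assumes "zero_fourier_coeffs L f" "zero_fourier_coeffs L g"
  shows "zero_fourier_coeffs L (\<lambda>x. f x + g x)"
  using zero_fourier_coeffs_integrable [OF assms(1)] zero_fourier_coeffs_integrable [OF assms(2)] assms
  by (auto simp: zero_fourier_coeffs_def distrib_right)

lemma zero_fourier_coeffs_mult_const:
  assumes "zero_fourier_coeffs L f"
  shows "zero_fourier_coeffs L (\<lambda>x. c * f x)"
  using assms zero_fourier_coeffs_integrable [OF assms(1)]
  by (auto simp: zero_fourier_coeffs_def mult.assoc)

text \<open>
  Multiplication by a harmonic only shifts the sequence of Fourier coefficients. This is why the
  property asks for all integer frequencies: it makes the class a module over the trigonometric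
  polynomials.
\<close>

lemma zero_fourier_coeffs_mult_harmonic:
  assumes "zero_fourier_coeffs L f"
  shows "zero_fourier_coeffs L (\<lambda>x. harmonic L m x * f x)"
proof -
  have shift: "harmonic L m x * f x * harmonic L n x = f x * harmonic L (m + n) x" for x n
    by (simp add: harmonic_add)
  have "integrable (period_measure L) (\<lambda>x. harmonic L m x * f x)"
    using zero_fourier_coeffs_integrable [OF assms, of m] by (simp only: mult.commute)
  then show ?thesis
    using assms unfolding zero_fourier_coeffs_def shift by simp
qed

text \<open>
  A real polynomial in the real and imaginary part of a point \<open>z\<close> of the unit circle is a
  polynomial in \<open>z\<close> and \<open>cnj z\<close>, that is, a trigonometric polynomial. Inducting over the polynomial
  with \<open>h\<close> arbitrary lets a product be treated as two successive multiplications, so no normal form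
  for trigonometric polynomials is required.
\<close>

lemma zero_fourier_coeffs_mult_polynomial:
  assumes "real_polynomial_function p"
  shows "zero_fourier_coeffs L h \<Longrightarrow> zero_fourier_coeffs L (\<lambda>x. of_real (p (harmonic L 1 x)) * h x)"
  using assms
proof (induction p arbitrary: h rule: real_polynomial_function.induct)
  case (linear p)
  interpret bounded_linear p by fact
  \<comment> \<open>Writing \<open>2 Re z = z + cnj z\<close> and \<open>2 \<i> Im z = z - cnj z\<close> gives these coefficients of \<open>z\<close> and \<open>cnj z\<close>.\<close>
  define a where "a = (of_real (p 1) - \<i> * of_real (p \<i>)) / 2"
  define b where "b = (of_real (p 1) + \<i> * of_real (p \<i>)) / 2"
  have eq: "of_real (p (harmonic L 1 x)) * h x =
      a * (harmonic L 1 x * h x) + b * (harmonic L (-1) x * h x)" for x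
  proof -
    let ?z = "harmonic L 1 x"
    have "p ?z = p (Re ?z *\<^sub>R 1 + Im ?z *\<^sub>R \<i>)"
      by (intro arg_cong [where f=p]) (simp add: complex_eq_iff)
    also have "\<dots> = Re ?z * p 1 + Im ?z * p \<i>"
      by (simp only: add scaleR real_scaleR_def)
    finally have "p ?z = Re ?z * p 1 + Im ?z * p \<i>" .
    moreover have "harmonic L (-1) x = cnj ?z"
      by (simp add: harmonic_def cis_cnj)
    ultimately have "of_real (p ?z) = a * ?z + b * harmonic L (-1) x"
      by (simp add: a_def b_def complex_eq_iff field_simps)
    then show ?thesis by (simp add: algebra_simps)
  qed
  show ?case
    unfolding eq
    by (intro zero_fourier_coeffs_add zero_fourier_coeffs_mult_const zero_fourier_coeffs_mult_harmonic linear.prems)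
next
  case (const c)
  then show ?case by (intro zero_fourier_coeffs_mult_const)
next
  case (add p q)
  then show ?case
    using zero_fourier_coeffs_add [OF add.IH] by (simp add: distrib_right)
next
  case (mult p q)
  then show ?case
    by (simp add: mult.assoc)
qed

text \<open>
  By Stone--Weierstrass, polynomials are uniformly dense in the continuous functions on the unit
  circle, and integration against an integrable \<open>h\<close> is continuous for uniform convergence. Test
  functions are taken on the circle, in the form \<open>q (harmonic L 1 x)\<close>, because the harmonics do not
  separate the endpoints of the interval.
\<close>

lemma zero_fourier_coeffs_imp_orthogonal_continuous:
  fixes q :: "complex \<Rightarrow> real"
  assumes h: "zero_fourier_coeffs L h" and q: "continuous_on UNIV q"
  shows "(LINT x|period_measure L. of_real (q (harmonic L 1 x)) * h x) = 0"
proof (rule ccontr)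
  let ?M = "period_measure L"
  let ?I = "LINT x|?M. of_real (q (harmonic L 1 x)) * h x"
  assume "?I \<noteq> 0"
  \<comment> \<open>The summand \<open>1\<close> keeps the bound positive when \<open>h\<close> vanishes almost everywhere.\<close>
  define C where "C = (LINT x|?M. norm (h x)) + 1"
  have hint: "integrable ?M h" using h by (simp add: zero_fourier_coeffs_def)
  have Cpos: "C > 0" unfolding C_def by (simp add: add_nonneg_pos)
  define e where "e = norm ?I / (2 * C)"
  have "e > 0" using \<open>?I \<noteq> 0\<close> Cpos by (simp add: e_def)
  obtain p where p: "real_polynomial_function p"
    and pq: "\<And>z. z \<in> sphere 0 1 \<Longrightarrow> \<bar>q z - p z\<bar> < e"
    using Stone_Weierstrass_real_polynomial_function [of "sphere 0 1" q e] \<open>e > 0\<close> 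
      continuous_on_subset [OF q] by auto
  have contq: "continuous_on {-L..L} (\<lambda>x. complex_of_real (q (harmonic L 1 x)))"
    using continuous_on_compose2 [OF q continuous_on_harmonic] by (auto intro!: continuous_intros)
  have iq: "integrable ?M (\<lambda>x. of_real (q (harmonic L 1 x)) * h x)"
  proof -
    have "bounded ((\<lambda>x. complex_of_real (q (harmonic L 1 x))) ` {-L..L})"
      using compact_continuous_image [OF contq] by (auto intro: compact_imp_bounded)
    then obtain B where "\<And>x. x \<in> {-L..L} \<Longrightarrow> norm (complex_of_real (q (harmonic L 1 x))) \<le> B"
      unfolding bounded_iff by blast
    then have "integrable ?M (\<lambda>x. h x * of_real (q (harmonic L 1 x)))"
      by (intro integrable_mult_bounded [OF hint, where C=B] continuous_imp_measurable_on_sets_lebesgue contq) auto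
    then show ?thesis by (simp add: mult.commute)
  qed
  have zp: "zero_fourier_coeffs L (\<lambda>x. of_real (p (harmonic L 1 x)) * h x)"
    by (intro zero_fourier_coeffs_mult_polynomial p h)
  then have ip: "integrable ?M (\<lambda>x. of_real (p (harmonic L 1 x)) * h x)"
    and p0: "(LINT x|?M. of_real (p (harmonic L 1 x)) * h x) = 0"
    using zp [unfolded zero_fourier_coeffs_def, THEN conjunct2, rule_format, of 0] by (auto simp: zero_fourier_coeffs_def)
  have "norm ?I = norm (LINT x|?M. of_real (q (harmonic L 1 x)) * h x - of_real (p (harmonic L 1 x)) * h x)"
    using iq ip p0 by simp
  also have "\<dots> \<le> (LINT x|?M. e * norm (h x))"
  proof (intro Bochner_Integration.integral_norm_bound_integral Bochner_Integration.integrable_diff iq ip)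
    fix x
    have "norm (of_real (q (harmonic L 1 x)) * h x - of_real (p (harmonic L 1 x)) * h x) 
        = \<bar>q (harmonic L 1 x) - p (harmonic L 1 x)\<bar> * norm (h x)"
      by (simp flip: left_diff_distrib of_real_diff add: norm_mult)
    also have "\<dots> \<le> e * norm (h x)"
      using pq [of "harmonic L 1 x"] by (intro mult_right_mono) auto
    finally show "norm (of_real (q (harmonic L 1 x)) * h x - of_real (p (harmonic L 1 x)) * h x) \<le> e * norm (h x)" .
  qed (use hint in auto)
  also have "\<dots> = e * (C - 1)" by (simp add: C_def)
  also have "\<dots> < norm ?I"
  proof -
    have "2 * (e * C) = norm ?I" using Cpos by (simp add: e_def)
    moreover have "0 < e * C" using \<open>e > 0\<close> Cpos by simp
    ultimately show ?thesis using \<open>e > 0\<close> by (simp only: right_diff_distrib)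
  qed
  finally show False by simp
qed

text \<open>
  The endpoints \<open>-L\<close> and \<open>L\<close> are both sent to the point \<open>-1\<close> of the circle, so one of the two points
  has to be interior.
\<close>

lemma harmonic_1_eq_iff:
  assumes "L > 0" "x \<in> {-L<..<L}" "y \<in> {-L..L}"
  shows "harmonic L 1 x = harmonic L 1 y \<longleftrightarrow> x = y"
proof
  assume eq: "harmonic L 1 x = harmonic L 1 y"
  then obtain k where "pi * x / L = pi * y / L + 2 * pi * of_int k"
    using sin_cos_eq_iff [of "pi * x / L" "pi * y / L"]
    by (auto simp: harmonic_def complex_eq_iff)
  then have "pi * (x - y) = pi * (2 * of_int k * L)"
    using assms by (simp add: field_simps)
  then have k: "x - y = 2 * of_int k * L" by simp
  have "\<bar>x - y\<bar> < 2 * L" using assms by auto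
  then have "\<bar>of_int k :: real\<bar> < 1" 
    using assms k by (simp add: abs_mult)
  then have "k = 0" by linarith
  then show "x = y" using k by simp
qed simp

lemma AE_period_not_in_finite: "finite A \<Longrightarrow> AE x in period_measure L. x \<notin> A"
proof -
  assume "finite A"
  then have "A \<in> null_sets lebesgue"
    by (intro null_sets_completionI finite_imp_null_set_lborel)
  then have "AE x in lebesgue. x \<notin> A" by (rule AE_not_in)
  then show ?thesis by (subst AE_restrict_space_iff) auto
qed

text \<open>
  The image of \<open>K\<close> on the circle is compact, so its indicator is a pointwise limit of continuous
  cut-offs of the distance to it; pulled back to the interval it is the indicator of \<open>K\<close>, except
  possibly at the endpoints, which form a null set.
\<close>

lemma set_integral_compact_eq_0:
  assumes L: "L > 0" and h: "zero_fourier_coeffs L h" and K: "compact K" "K \<subseteq> {-L..L}" "K \<noteq> {}"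
  shows "(LINT x|period_measure L. indicator K x *\<^sub>R h x) = 0"
proof -
  let ?M = "period_measure L"
  define A where "A = harmonic L 1 ` K"
  have "compact A" unfolding A_def by (intro compact_continuous_image continuous_intros K)
  then have clA: "closed A" "A \<noteq> {}" using K by (auto simp: A_def compact_imp_closed)
  define q :: "nat \<Rightarrow> complex \<Rightarrow> real" where "q n z = max 0 (1 - real n * infdist z A)" for n z
  have qlim: "(\<lambda>n. q n z) \<longlonglongrightarrow> indicator A z" for z
  proof (cases "z \<in> A")
    case True then show ?thesis by (simp add: q_def)
  next
    case False
    then have pos: "infdist z A > 0" using clA by (simp add: infdist_pos_not_in_closed)
    obtain N where N: "1 / infdist z A < real N" using reals_Archimedean2 by blast
    have "q n z = 0" if "n \<ge> N" for n
    proof -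
      have "1 / infdist z A < real n" using N that by linarith
      then show ?thesis using pos by (simp add: q_def field_simps)
    qed
    then have "eventually (\<lambda>n. q n z = indicator A z) sequentially"
      using False by (auto simp: eventually_at_top_linorder)
    then show ?thesis by (rule tendsto_eventually)
  qed
  have hint: "integrable ?M h" using h by (simp add: zero_fourier_coeffs_def)
  have hm [measurable]: "h \<in> borel_measurable ?M" using hint by auto
  have hm1 [measurable]: "harmonic L 1 \<in> borel_measurable ?M" by (rule harmonic_measurable)
  have qc: "continuous_on UNIV (q n)" for n unfolding q_def by (intro continuous_intros)
  have [measurable]: "q n \<in> borel_measurable borel" for n
    by (intro borel_measurable_continuous_onI qc)
  have [measurable]: "A \<in> sets borel" using clA by auto
  have "(\<lambda>n. LINT x|?M. of_real (q n (harmonic L 1 x)) * h x) \<longlonglongrightarrow>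
      (LINT x|?M. of_real (indicator A (harmonic L 1 x)) * h x)"
  proof (rule integral_dominated_convergence [where w="\<lambda>x. norm (h x)"])
    show "AE x in ?M. norm (of_real (q n (harmonic L 1 x)) * h x) \<le> norm (h x)" for n
      by (intro AE_I2) (auto simp: norm_mult q_def infdist_nonneg intro!: mult_left_le_one_le)
    show "AE x in ?M. (\<lambda>n. complex_of_real (q n (harmonic L 1 x)) * h x)
         \<longlonglongrightarrow> complex_of_real (indicat_real A (harmonic L 1 x)) * h x"
      by (intro AE_I2 tendsto_intros qlim)
  qed (use hint in auto)
  then have "(LINT x|?M. of_real (indicator A (harmonic L 1 x)) * h x) = 0"
    using zero_fourier_coeffs_imp_orthogonal_continuous [OF h qc] by (simp add: LIMSEQ_const_iff)
  moreover have "(LINT x|?M. of_real (indicator A (harmonic L 1 x)) * h x) =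
     (LINT x|?M. indicator K x *\<^sub>R h x)"
  proof (rule integral_cong_AE)
    have "K \<in> sets ?M" using K by (auto simp: sets_restrict_space_iff compact_imp_closed)
    then show "(\<lambda>x. indicator K x *\<^sub>R h x) \<in> borel_measurable ?M" by measurable
    have "AE x in ?M. x \<notin> {-L, L}" by (rule AE_period_not_in_finite) auto
    then show "AE x in ?M. of_real (indicator A (harmonic L 1 x)) * h x = indicator K x *\<^sub>R h x"
      using AE_space
    proof eventually_elim
      case (elim x)
      then have "x \<in> {-L<..<L}" by auto
      then have "harmonic L 1 x \<in> A \<longleftrightarrow> x \<in> K"
        using harmonic_1_eq_iff [OF L, of x] K(2) unfolding A_def by blast
      then show ?case by (simp add: indicator_def)
    qed
  qed measurable
  ultimately show ?thesis by simp
qed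

text \<open>
  Up to a null set, every Lebesgue set is an increasing union of compact sets. Hence \<open>h\<close> has
  integral zero over every measurable set, which determines it almost everywhere.
\<close>

lemma zero_fourier_coeffs_imp_AE_0:
  assumes L: "L > 0" and h: "zero_fourier_coeffs L h"
  shows "AE x in period_measure L. h x = 0"
proof -
  let ?M = "period_measure L"
  interpret finite_measure ?M by (rule finite_measure_period)
  show ?thesis
  proof (rule density_zero)
  show hint: "integrable ?M h" using h by (simp add: zero_fourier_coeffs_def)
  then have [measurable]: "h \<in> borel_measurable ?M" by auto
  fix A assume A: "A \<in> sets ?M"
  then have AL: "A \<in> sets lebesgue" "A \<subseteq> {-L..L}" by (auto simp: sets_restrict_space_iff)
  obtain C T where CT: "fsigma C" "T \<in> null_sets lebesgue" "C \<union> T = A"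
    using lebesgue_set_almost_fsigma [OF AL(1)] by metis
  obtain F :: "nat \<Rightarrow> real set" where "range F \<subseteq> Collect compact" "C = \<Union>(range F)"
    using CT(1) fsigma_Union_compact by metis
  then have F: "\<And>n. compact (F n)" "C = (\<Union>n. F n)" by auto
  define K where "K n = (\<Union>i\<le>n. F i)" for n
  have K: "compact (K n)" "K n \<subseteq> {-L..L}" for n
    using F CT(3) AL(2) by (auto simp: K_def intro!: compact_UN)
  then have Km [measurable]: "K n \<in> sets ?M" for n
    by (auto simp: sets_restrict_space_iff compact_imp_closed)
  have Cm [measurable]: "C \<in> sets ?M"
  proof -
    have "C = (\<Union>n. K n)" by (auto simp: F K_def)
    then show ?thesis by simp
  qed
  have lim: "(\<lambda>n. LINT x|?M. indicator (K n) x *\<^sub>R h x) \<longlonglongrightarrow> (LINT x|?M. indicator C x *\<^sub>R h x)"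
  proof (rule integral_dominated_convergence [where w="\<lambda>x. norm (h x)"])
    have "(\<lambda>n. indicat_real (K n) x) \<longlonglongrightarrow> indicator C x" for x
    proof (cases "x \<in> C")
      case True
      then obtain i where "x \<in> F i" by (auto simp: F)
      then have "eventually (\<lambda>n. indicat_real (K n) x = indicator C x) sequentially"
        using True by (auto simp: eventually_at_top_linorder K_def indicator_def intro!: exI [of _ i])
      then show ?thesis by (rule tendsto_eventually)
    qed (auto simp: F K_def indicator_def)
    then show "AE x in ?M. (\<lambda>n. indicat_real (K n) x *\<^sub>R h x) \<longlonglongrightarrow> indicat_real C x *\<^sub>R h x"
      by (intro AE_I2 tendsto_intros)
  qed (use hint in \<open>auto simp: indicator_def\<close>)
  have "(LINT x|?M. indicator (K n) x *\<^sub>R h x) = 0" for n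
    using set_integral_compact_eq_0 [OF L h K] by (cases "K n = {}") auto
  then have "(LINT x|?M. indicator C x *\<^sub>R h x) = 0"
    using lim by (simp add: LIMSEQ_const_iff)
  moreover have "(LINT x|?M. indicator A x *\<^sub>R h x) = (LINT x|?M. indicator C x *\<^sub>R h x)"
  proof (rule integral_cong_AE)
    have "T \<in> null_sets ?M"
      using CT AL by (subst null_sets_restrict_space) auto
    then have "AE x in ?M. x \<notin> T" by (rule AE_not_in)
    then show "AE x in ?M. indicat_real A x *\<^sub>R h x = indicat_real C x *\<^sub>R h x"
      by (rule eventually_mono) (use CT(3) in \<open>auto simp: indicator_def\<close>)
  qed (use A in measurable)
  ultimately show "set_lebesgue_integral ?M A h = 0"
    by (simp add: set_lebesgue_integral_def)
  qed
qed

section \<open>Primitives and the product rule\<close>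

definition primitive :: "real \<Rightarrow> (real \<Rightarrow> complex) \<Rightarrow> real \<Rightarrow> complex" where
  "primitive L f x = (LINT t|period_measure L. (if t \<le> x then f t else 0))"

lemma id_measurable_period: "(\<lambda>x. x) \<in> borel_measurable (period_measure L)"
  by (intro continuous_imp_measurable_on_sets_lebesgue continuous_intros) auto

lemma integrable_truncated:
  fixes f :: "real \<Rightarrow> complex"
  assumes "integrable (period_measure L) f"
  shows "integrable (period_measure L) (\<lambda>t. if t \<le> x then f t else 0)"
proof (rule Bochner_Integration.integrable_bound [OF assms])
  note [measurable] = id_measurable_period borel_measurable_integrable [OF assms]
  show "(\<lambda>t. if t \<le> x then f t else 0) \<in> borel_measurable (period_measure L)"
    by measurable
qed (auto intro!: AE_I2)

lemma primitive_measurable: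
  assumes "integrable (period_measure L) f"
  shows "primitive L f \<in> borel_measurable (period_measure L)"
proof -
  interpret finite_measure "period_measure L" by (rule finite_measure_period)
  note [measurable] = id_measurable_period borel_measurable_integrable [OF assms]
  show ?thesis
    unfolding primitive_def [abs_def] by measurable
qed

lemma norm_primitive_le:
  assumes "integrable (period_measure L) f"
  shows "norm (primitive L f x) \<le> (LINT t|period_measure L. norm (f t))"
  unfolding primitive_def
  by (intro Bochner_Integration.integral_norm_bound_integral integrable_truncated assms integrable_norm) auto

lemma primitive_cnj: "primitive L (\<lambda>t. cnj (f t)) x = cnj (primitive L f x)"
proof -
  have "(if t \<le> x then cnj (f t) else 0) = cnj (if t \<le> x then f t else 0)" for t
    by simp
  then show ?thesis
    by (simp only: primitive_def Bochner_Integration.integral_cnj)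
qed

lemma integrable_mult_primitive:
  assumes "integrable (period_measure L) f" "integrable (period_measure L) g"
  shows "integrable (period_measure L) (\<lambda>x. f x * primitive L g x)"
  using norm_primitive_le [OF assms(2)] primitive_measurable [OF assms(2)]
  by (intro integrable_mult_bounded [OF assms(1)])

text \<open>
  The square of pairs \<open>(x, t)\<close> splits along its diagonal, a null set. By Fubini, the two integrals on
  the left are the integrals of \<open>f x * g t\<close> over the two triangles, and the right-hand side is the
  integral over the whole square.
\<close>

lemma product_rule_primitive:
  assumes f: "integrable (period_measure L) f" and g: "integrable (period_measure L) g"
  shows "(LINT x|period_measure L. f x * primitive L g x) + (LINT x|period_measure L. g x * primitive L f x)
       = (LINT x|period_measure L. f x) * (LINT x|period_measure L. g x)"
proof -
  let ?M = "period_measure L"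
  interpret finite_measure ?M by (rule finite_measure_period)
  interpret P: pair_sigma_finite ?M ?M by unfold_locales
  note [measurable] = id_measurable_period borel_measurable_integrable [OF f] borel_measurable_integrable [OF g]
  have prod: "integrable (?M \<Otimes>\<^sub>M ?M) (\<lambda>(x, t). f x * g t)"
    by (rule P.Fubini_integrable) (use f g in \<open>auto simp: norm_mult\<close>)
  \<comment> \<open>The integrand on the triangle above the diagonal.\<close>
  define T where "T x t = (if x \<le> t then f x * g t else 0)" for x t
  have int: "integrable (?M \<Otimes>\<^sub>M ?M) (case_prod T)"
  proof (rule Bochner_Integration.integrable_bound [OF prod])
    show "case_prod T \<in> borel_measurable (?M \<Otimes>\<^sub>M ?M)"
      unfolding T_def by measurable
  qed (auto simp: T_def intro!: AE_I2)
  have "(LINT t|?M. g t * primitive L f t) = (LINT t|?M. LINT x|?M. T x t)"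
  proof (rule Bochner_Integration.integral_cong [OF refl])
    fix t
    have "T x t = g t * (if x \<le> t then f x else 0)" for x
      by (simp add: T_def)
    then show "g t * primitive L f t = (LINT x|?M. T x t)"
      by (simp add: primitive_def)
  qed
  also have "\<dots> = (LINT x|?M. LINT t|?M. T x t)"
    by (rule P.Fubini_integral [OF int])
  finally have eq: "(LINT t|?M. g t * primitive L f t) = (LINT x|?M. LINT t|?M. T x t)" .
  have i1: "integrable ?M (\<lambda>x. LINT t|?M. T x t)"
    using P.integrable_fst [OF int] by simp
  have "(LINT x|?M. f x * primitive L g x) + (LINT x|?M. LINT t|?M. T x t)
      = (LINT x|?M. f x * primitive L g x + (LINT t|?M. T x t))"
    by (intro Bochner_Integration.integral_add [symmetric] i1 integrable_mult_primitive f g)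
  also have "\<dots> = (LINT x|?M. f x * (LINT t|?M. g t))"
  proof (rule Bochner_Integration.integral_cong [OF refl])
    fix x
    have it: "integrable ?M (\<lambda>t. if t \<le> x then g t else 0)"
      by (rule integrable_truncated [OF g])
    have it2: "integrable ?M (\<lambda>t. if x \<le> t then g t else 0)"
      by (rule Bochner_Integration.integrable_bound [OF g]) (auto intro!: AE_I2)
    have "(LINT t|?M. T x t) = f x * (LINT t|?M. (if x \<le> t then g t else 0))"
    proof -
      have "T x t = f x * (if x \<le> t then g t else 0)" for t
        by (simp add: T_def)
      then show ?thesis by simp
    qed
    then have "f x * primitive L g x + (LINT t|?M. T x t) =
       f x * (LINT t|?M. (if t \<le> x then g t else 0) + (if x \<le> t then g t else 0))"
      using it it2 by (simp add: primitive_def distrib_left)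
    also have "(LINT t|?M. (if t \<le> x then g t else 0) + (if x \<le> t then g t else 0)) = (LINT t|?M. g t)"
    proof (rule integral_cong_AE)
      have "AE t in ?M. t \<notin> {x}" by (rule AE_period_not_in_finite) auto
      then show "AE t in ?M. (if t \<le> x then g t else 0) + (if x \<le> t then g t else 0) = g t"
        by (rule eventually_mono) auto
    qed measurable
    finally show "f x * primitive L g x + (LINT t|?M. T x t) = f x * (LINT t|?M. g t)" .
  qed
  also have "\<dots> = (LINT x|?M. f x) * (LINT x|?M. g x)" by simp
  finally show ?thesis using eq by simp
qed

lemma primitive_of_derivative:
  fixes F F' :: "real \<Rightarrow> complex"
  assumes der: "\<And>t. (F has_vector_derivative F' t) (at t)" and cont: "continuous_on {-L..L} F'"
    and x: "x \<in> {-L..L}"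
  shows "primitive L F' x = F x - F (-L)"
proof -
  have int: "integrable (lebesgue_on {-L..x}) F'"
    using x by (intro continuous_integrable_interval continuous_on_subset [OF cont]) auto
  have "primitive L F' x = (LINT t|lebesgue_on {-L..x}. F' t)"
    unfolding primitive_def using x
    by (subst (1 2) integral_restrict_space)
       (auto intro!: Bochner_Integration.integral_cong simp: indicator_def)
  also have "\<dots> = integral {-L..x} F'"
    by (intro lebesgue_integral_eq_integral int) auto
  also have "\<dots> = F x - F (-L)"
    using x by (intro integral_unique fundamental_theorem_of_calculus)
      (auto intro: has_vector_derivative_at_within der)
  finally show ?thesis .
qed

section \<open>Integration by parts for weak derivatives\<close>

lemma L2_per_integrable:
  assumes "f \<in> L2_per L"
  shows "integrable (period_measure L) f"
proof -
  interpret finite_measure "period_measure L" by (rule finite_measure_period)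
  have m: "f \<in> borel_measurable (period_measure L)" using assms by (simp add: L2_per_def)
  have "integrable (period_measure L) (\<lambda>x. cmod (f x))"
    by (rule square_integrable_imp_integrable) (use assms in \<open>auto simp: L2_per_def\<close>)
  then show ?thesis using m integrable_norm_cancel by blast
qed

lemma L2_per_mult_integrable:
  assumes "f \<in> L2_per L" "g \<in> L2_per L"
  shows "integrable (period_measure L) (\<lambda>x. f x * g x)"
proof (rule Bochner_Integration.integrable_bound)
  show "integrable (period_measure L) (\<lambda>x. (cmod (f x))\<^sup>2 + (cmod (g x))\<^sup>2)"
    using assms by (auto simp: L2_per_def)
  have [measurable]: "f \<in> borel_measurable (period_measure L)" "g \<in> borel_measurable (period_measure L)"
    using assms by (auto simp: L2_per_def)
  show "(\<lambda>x. f x * g x) \<in> borel_measurable (period_measure L)" by measurable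
  have "a * b \<le> a\<^sup>2 + b\<^sup>2" if "a \<ge> 0" "b \<ge> 0" for a b :: real
    using sum_squares_bound [of a b] that mult_nonneg_nonneg [OF that] by linarith
  then show "AE x in period_measure L. cmod (f x * g x) \<le> norm ((cmod (f x))\<^sup>2 + (cmod (g x))\<^sup>2)"
    by (intro AE_I2) (simp add: norm_mult)
qed

lemma L2_per_cnj: "f \<in> L2_per L \<Longrightarrow> (\<lambda>x. cnj (f x)) \<in> L2_per L"
proof -
  assume f: "f \<in> L2_per L"
  then interpret periodic_fun_simple f "2 * L" by (simp add: L2_per_def)
  have "periodic_fun_simple (\<lambda>x. cnj (f x)) (2 * L)"
    by unfold_locales (simp add: plus_1)
  moreover have "(\<lambda>x. cnj (f x)) \<in> borel_measurable (period_measure L)"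
    using f by (intro measurable_compose [of f _ borel cnj] borel_measurable_continuous_onI continuous_intros)
      (auto simp: L2_per_def)
  ultimately show ?thesis using f by (simp add: L2_per_def)
qed

text \<open>
  The absolutely continuous description of a weak derivative on the torus: up to a null set \<open>f\<close> is
  a primitive of \<open>g\<close>, and the vanishing mean of \<open>g\<close> makes the two boundary values of that primitive
  agree. In contrast to the definition by smooth test functions, it is visibly stable under complex
  conjugation and can be inserted into the product rule.
\<close>

definition has_periodic_primitive :: "real \<Rightarrow> (real \<Rightarrow> complex) \<Rightarrow> (real \<Rightarrow> complex) \<Rightarrow> bool" where
  "has_periodic_primitive L f g \<longleftrightarrow> integrable (period_measure L) g \<and> (LINT x|period_measure L. g x) = 0 \<and>
     f \<in> borel_measurable (period_measure L) \<and>
     (\<exists>c. AE x in period_measure L. f x = c + primitive L g x)"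

lemma has_periodic_primitive_cnj:
  assumes "has_periodic_primitive L f g"
  shows "has_periodic_primitive L (\<lambda>x. cnj (f x)) (\<lambda>x. cnj (g x))"
proof -
  obtain c where c: "AE x in period_measure L. f x = c + primitive L g x"
    using assms by (auto simp: has_periodic_primitive_def)
  have "AE x in period_measure L. cnj (f x) = cnj c + primitive L (\<lambda>x. cnj (g x)) x"
    using c by (rule eventually_mono) (simp add: primitive_cnj)
  moreover have "(\<lambda>x. cnj (f x)) \<in> borel_measurable (period_measure L)"
    using assms by (intro measurable_compose [of f _ borel cnj] borel_measurable_continuous_onI continuous_intros)
      (auto simp: has_periodic_primitive_def)
  ultimately show ?thesis
    using assms by (auto simp: has_periodic_primitive_def)
qed

text \<open>
  The constants of integration multiply the means of \<open>g\<close> and \<open>k\<close>, which vanish; for the same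
  reason there is no boundary term in the product rule.
\<close>

lemma integration_by_parts_periodic:
  assumes fg: "has_periodic_primitive L f g" and hk: "has_periodic_primitive L h k"
  shows "(LINT x|period_measure L. f x * k x) = - (LINT x|period_measure L. g x * h x)"
proof -
  let ?M = "period_measure L"
  obtain c where c: "AE x in ?M. f x = c + primitive L g x"
    using fg by (auto simp: has_periodic_primitive_def)
  obtain d where d: "AE x in ?M. h x = d + primitive L k x"
    using hk by (auto simp: has_periodic_primitive_def)
  have g: "integrable ?M g" "(LINT x|?M. g x) = 0" and fm [measurable]: "f \<in> borel_measurable ?M"
    using fg by (auto simp: has_periodic_primitive_def)
  have k: "integrable ?M k" "(LINT x|?M. k x) = 0" and hm [measurable]: "h \<in> borel_measurable ?M"
    using hk by (auto simp: has_periodic_primitive_def)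
  note [measurable] = borel_measurable_integrable [OF g(1)] borel_measurable_integrable [OF k(1)]
    primitive_measurable [OF g(1)] primitive_measurable [OF k(1)]
  have "(LINT x|?M. f x * k x) = (LINT x|?M. c * k x + k x * primitive L g x)"
  proof (rule integral_cong_AE)
    show "AE x in ?M. f x * k x = c * k x + k x * primitive L g x"
      using c by (rule eventually_mono) (simp add: algebra_simps)
  qed measurable
  also have "\<dots> = (LINT x|?M. k x * primitive L g x)"
    using k integrable_mult_primitive [OF k(1) g(1)] by simp
  finally have 1: "(LINT x|?M. f x * k x) = (LINT x|?M. k x * primitive L g x)" .
  have "(LINT x|?M. g x * h x) = (LINT x|?M. d * g x + g x * primitive L k x)"
  proof (rule integral_cong_AE)
    show "AE x in ?M. g x * h x = d * g x + g x * primitive L k x"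
      using d by (rule eventually_mono) (simp add: algebra_simps)
  qed measurable
  also have "\<dots> = (LINT x|?M. g x * primitive L k x)"
    using g integrable_mult_primitive [OF g(1) k(1)] by simp
  finally have 2: "(LINT x|?M. g x * h x) = (LINT x|?M. g x * primitive L k x)" .
  show ?thesis
    using product_rule_primitive [OF g(1) k(1)] g(2) unfolding 1 2 by (simp add: add_eq_0_iff)
qed

lemma weak_deriv_test_harmonic:
  assumes L: "L > 0" and wd: "has_weak_deriv_per L f g"
  shows "(\<i> * of_real (pi * of_int n / L)) * (LINT x|period_measure L. f x * harmonic L n x)
     = - (LINT x|period_measure L. g x * harmonic L n x)"
proof -
  define c where "c = \<i> * of_real (pi * of_int n / L)"
  have "(LINT x|period_measure L. f x * vector_derivative (harmonic L n) (at x)) 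
     = - (LINT x|period_measure L. g x * harmonic L n x)"
    using wd L smooth_harmonic [of L n] periodic_harmonic [of L n]
    by (simp add: has_weak_deriv_per_def)
  moreover have "f x * vector_derivative (harmonic L n) (at x) = c * (f x * harmonic L n x)" for x
    by (simp add: vector_derivative_at [OF harmonic_has_vector_derivative] c_def)
  ultimately show ?thesis unfolding c_def by simp
qed

lemma integral_weak_deriv_eq_0:
  assumes L: "L > 0" and wd: "has_weak_deriv_per L f g"
  shows "(LINT x|period_measure L. g x) = 0"
  using weak_deriv_test_harmonic [OF assms, of 0] by simp

text \<open>
  The primitive obeys the same relation to the Fourier coefficients of \<open>g\<close> as a function with weak
  derivative \<open>g\<close>. It comes from the product rule for \<open>g\<close> and the derivative of the harmonic, whose
  boundary constant is killed by the mean of \<open>g\<close>.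
\<close>

lemma primitive_test_harmonic:
  assumes L: "L > 0" and g: "integrable (period_measure L) g" "(LINT x|period_measure L. g x) = 0"
  shows "(\<i> * of_real (pi * of_int n / L)) * (LINT x|period_measure L. primitive L g x * harmonic L n x)
     = - (LINT x|period_measure L. g x * harmonic L n x)"
proof -
  let ?M = "period_measure L"
  define c where "c = \<i> * of_real (pi * of_int n / L)"
  define e' where "e' x = c * harmonic L n x" for x
  have der: "(harmonic L n has_vector_derivative e' x) (at x)" for x
    unfolding e'_def c_def by (rule harmonic_has_vector_derivative)
  have cont: "continuous_on {-L..L} e'"
    unfolding e'_def by (intro continuous_intros)
  have prim: "primitive L e' x = harmonic L n x - harmonic L n (-L)" if "x \<in> {-L..L}" for x
    by (rule primitive_of_derivative [OF der cont that])
  have e'_int: "integrable ?M e'" by (rule continuous_integrable_interval [OF cont])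
  have gn: "integrable ?M (\<lambda>x. g x * harmonic L n x)"
    by (intro integrable_mult_bounded [where C=1] harmonic_measurable g) auto
  have "(LINT x|?M. e' x * primitive L g x) = - (LINT x|?M. g x * primitive L e' x)"
    using product_rule_primitive [OF e'_int g(1)] g(2) by (simp add: add_eq_0_iff)
  also have "(LINT x|?M. g x * primitive L e' x) = (LINT x|?M. g x * harmonic L n x - g x * harmonic L n (-L))"
    by (intro Bochner_Integration.integral_cong) (auto simp: prim right_diff_distrib)
  also have "\<dots> = (LINT x|?M. g x * harmonic L n x)"
    using g gn by simp
  finally show ?thesis
    by (simp add: e'_def c_def mult_ac)
qed

lemma integral_harmonic_eq_0:
  assumes L: "L > 0" and n: "n \<noteq> 0"
  shows "(LINT x|period_measure L. harmonic L n x) = 0"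
proof -
  define c where "c = \<i> * of_real (pi * of_int n / L)"
  interpret periodic_fun_simple "harmonic L n" "2 * L" using L by (intro periodic_harmonic) auto
  have "c * (LINT x|period_measure L. harmonic L n x) = (LINT x|period_measure L. c * harmonic L n x)"
    by simp
  also have "\<dots> = primitive L (\<lambda>x. c * harmonic L n x) L"
    unfolding primitive_def by (intro Bochner_Integration.integral_cong) auto
  also have "\<dots> = harmonic L n L - harmonic L n (-L)"
    unfolding c_def
    by (rule primitive_of_derivative [OF harmonic_has_vector_derivative])
      (use L in \<open>auto intro!: continuous_intros\<close>)
  also have "\<dots> = 0" using plus_1 [of "-L"] by simp
  finally show ?thesis using L n by (simp add: c_def)
qed

text \<open>
  Testing with the harmonics shows that \<open>f\<close> and the primitive of \<open>g\<close> have the same Fourier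
  coefficients at every nonzero frequency. Subtracting the mean of their difference removes the
  remaining coefficient, so the two differ by a constant almost everywhere.
\<close>

lemma has_weak_deriv_imp_primitive:
  assumes L: "L > 0" and wd: "has_weak_deriv_per L f g"
  shows "has_periodic_primitive L f g"
proof -
  let ?M = "period_measure L"
  interpret finite_measure ?M by (rule finite_measure_period)
  have f: "integrable ?M f" and g: "integrable ?M g"
    using wd by (auto simp: has_weak_deriv_per_def intro: L2_per_integrable)
  have g0: "(LINT x|?M. g x) = 0" by (rule integral_weak_deriv_eq_0 [OF L wd])
  have G: "integrable ?M (primitive L g)"
    using integrable_mult_primitive [of L "\<lambda>_. 1" g] g by simp
  have mass: "measure ?M {-L..L} = 2 * L"
    using L by (simp add: measure_restrict_space)
  \<comment> \<open>The mean of the difference over a period.\<close>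
  define c where "c = (LINT x|?M. f x - primitive L g x) / of_real (2 * L)"
  define h where "h x = f x - primitive L g x - c" for x
  have "(LINT x|?M. h x * harmonic L n x) = 0" for n
  proof (cases "n = 0")
    case True
    have "(LINT x|?M. c) = of_real (2 * L) * c"
      using L by (simp add: mass scaleR_conv_of_real)
    then show ?thesis using True f G L by (simp add: h_def c_def)
  next
    case False
    have i: "integrable ?M (\<lambda>x. k x * harmonic L n x)" if "integrable ?M k" for k
      by (intro integrable_mult_bounded [where C=1] harmonic_measurable that) auto
    have "(\<i> * of_real (pi * of_int n / L)) * (LINT x|?M. f x * harmonic L n x)
        = (\<i> * of_real (pi * of_int n / L)) * (LINT x|?M. primitive L g x * harmonic L n x)"
      unfolding weak_deriv_test_harmonic [OF L wd] primitive_test_harmonic [OF L g g0] ..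
    then have "(LINT x|?M. f x * harmonic L n x) = (LINT x|?M. primitive L g x * harmonic L n x)"
      using False L by simp
    moreover have "(LINT x|?M. h x * harmonic L n x) = (LINT x|?M. f x * harmonic L n x)
       - (LINT x|?M. primitive L g x * harmonic L n x) - c * (LINT x|?M. harmonic L n x)"
      using i [OF f] i [OF G] i [of "\<lambda>_. c"] by (simp add: h_def left_diff_distrib)
    ultimately show ?thesis using integral_harmonic_eq_0 [OF L False] by simp
  qed
  moreover have "integrable ?M h" unfolding h_def using f G by simp
  ultimately have "AE x in ?M. h x = 0"
    by (intro zero_fourier_coeffs_imp_AE_0 L) (simp add: zero_fourier_coeffs_def)
  then have "AE x in ?M. f x = c + primitive L g x"
    by (rule eventually_mono) (simp add: h_def algebra_simps)
  then show ?thesis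
    unfolding has_periodic_primitive_def using g g0 borel_measurable_integrable [OF f] by blast
qed

section \<open>The energy identity and the sign of the eigenvalue\<close>

text \<open>
  This would be the definition of the weak derivative of \<open>v\<close> if \<open>cnj u\<close> were an admissible test
  function; as \<open>u\<close> is only weakly differentiable, it is integration by parts for primitives.
\<close>

lemma energy_identity:
  assumes L: "L > 0" and u: "has_weak_deriv_per L u u'" and v: "has_weak_deriv_per L v w"
  shows "(LINT x|period_measure L. cnj (u x) * w x) = - (LINT x|period_measure L. cnj (u' x) * v x)"
  by (intro integration_by_parts_periodic has_periodic_primitive_cnj has_weak_deriv_imp_primitive L u v)

text \<open>
  The eigenvalue is \<open>- a / b\<close>, with \<open>- a\<close> in the second and \<open>b\<close> in the first quadrant, so its
  argument can be taken between \<open>0\<close> and \<open>pi\<close>.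
\<close>

lemma Im_ratio_nonneg:
  fixes a b ev :: complex
  assumes "ev * b = - a" "Re a \<ge> 0" "Im a \<le> 0" "Re b > 0" "Im b \<ge> 0"
  shows "Im ev \<ge> 0"
proof -
  have "ev * b * cnj b = - (a * cnj b)" using assms(1) by simp
  then have "ev * of_real ((cmod b)\<^sup>2) = - (a * cnj b)"
    by (simp only: mult.assoc complex_norm_square)
  then have "Im ev * (cmod b)\<^sup>2 = Im (- (a * cnj b))"
    by (metis Im_complex_of_real Re_complex_of_real add.right_neutral add_0 mult_zero_right times_complex.simps(2))
  also have "\<dots> = - (Im a * Re b) + Re a * Im b" by simp
  also have "\<dots> \<ge> 0" using assms by (intro add_nonneg_nonneg) (auto simp: mult_nonpos_nonneg)
  finally show ?thesis using assms(4) by (auto simp: zero_le_mult_iff)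
qed

theorem proposition3p4:
  fixes k0 L Lstar \<theta> :: real
    and \<sigma> :: "real \<Rightarrow> real"
    and S :: "real \<Rightarrow> complex"
    and ev :: complex
  assumes "k0 > 0"
    and "0 < Lstar" and "Lstar < L"
    and "\<theta> \<in> {0<..<pi / 2}"
    and "\<sigma> \<in> borel_measurable (lebesgue_on {Lstar - L..<0})"
    and "bounded (\<sigma> ` {Lstar - L..<0})"
    and "is_stretching_function L Lstar \<theta> \<sigma> S"
    and "\<And>y. Re (S y) \<ge> 1"
    and "\<And>y. Im (S y) \<ge> 0"
    and "D_eigenvalue k0 L S ev"
  shows "Im ev \<ge> 0"
proof (cases "ev = 0")
  case False
  let ?M = "period_measure L"
  note k0 = \<open>k0 > 0\<close> and ReS = \<open>\<And>y. Re (S y) \<ge> 1\<close> and ImS = \<open>\<And>y. Im (S y) \<ge> 0\<close>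
  have L: "L > 0" using assms by simp
  have S0: "S y \<noteq> 0" for y using ReS [of y] by (auto simp: complex_eq_iff)
  obtain u u' w where u_nz: "\<not> (AE y in ?M. u y = 0)"
    and u': "has_weak_deriv_per L u u'"
    and w: "has_weak_deriv_per L (\<lambda>y. 1 / S y * u' y) w"
    and ode: "AE y in ?M. 1 / (of_real (k0\<^sup>2) * S y) * w y = ev * u y"
    using \<open>D_eigenvalue k0 L S ev\<close> unfolding D_eigenvalue_def D_op_def by blast
  have L2: "u \<in> L2_per L" "u' \<in> L2_per L" "(\<lambda>y. 1 / S y * u' y) \<in> L2_per L" "w \<in> L2_per L"
    using u' w by (auto simp: has_weak_deriv_per_def)
  define \<kappa> where "\<kappa> = of_real (k0\<^sup>2) * ev"
  have \<kappa>: "\<kappa> \<noteq> 0" using k0 False by (simp add: \<kappa>_def)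
  \<comment> \<open>The two densities of the energy identity. The second is the density of \<open>S |u|\<^sup>2\<close>, written through \<open>w\<close>
      so that its integrability follows from membership in \<open>L\<^sup>2\<close>.\<close>
  define a where "a y = cnj (u' y) * (1 / S y * u' y)" for y
  define b where "b y = cnj (u y) * w y / \<kappa>" for y
  have a_int: "integrable ?M a"
    unfolding a_def by (intro L2_per_mult_integrable L2_per_cnj L2)
  have b_int: "integrable ?M b"
    unfolding b_def using L2_per_mult_integrable [OF L2_per_cnj [OF L2(1)] L2(4)] by simp
  have b_eq: "AE y in ?M. b y = S y * of_real ((cmod (u y))\<^sup>2)"
    using ode
  proof (rule eventually_mono)
    fix y assume "1 / (of_real (k0\<^sup>2) * S y) * w y = ev * u y"
    then have "w y = \<kappa> * S y * u y"
      using k0 S0 [of y] by (simp add: \<kappa>_def field_simps)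
    then have "b y = S y * (u y * cnj (u y))" using \<kappa> by (simp add: b_def)
    then show "b y = S y * of_real ((cmod (u y))\<^sup>2)" by (simp only: complex_norm_square)
  qed
  have a_eq: "a y = cnj (S y) * of_real ((cmod (u' y))\<^sup>2 / (cmod (S y))\<^sup>2)" for y
  proof -
    have "a y = (u' y * cnj (u' y)) * (cnj (S y) / (S y * cnj (S y)))"
      using S0 [of y] by (simp add: a_def)
    then show ?thesis by (simp only: of_real_divide complex_norm_square) simp
  qed
  have "\<kappa> * (LINT y|?M. b y) = - (LINT y|?M. a y)"
    using energy_identity [OF L u' w] \<kappa> by (simp add: a_def b_def)
  then have "ev * (of_real (k0\<^sup>2) * (LINT y|?M. b y)) = - (LINT y|?M. a y)"
    by (simp add: \<kappa>_def mult_ac)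
  moreover have "Re (LINT y|?M. a y) \<ge> 0"
  proof -
    have "Re (a y) \<ge> 0" for y
      using ReS [of y] by (simp add: a_eq)
    then show ?thesis
      by (subst integral_Re [OF a_int, symmetric]) simp
  qed
  moreover have "Im (LINT y|?M. a y) \<le> 0"
  proof -
    have "- Im (a y) \<ge> 0" for y
      using ImS [of y] by (simp add: a_eq)
    then have "(LINT y|?M. - Im (a y)) \<ge> 0"
      by (intro Bochner_Integration.integral_nonneg)
    then show ?thesis using integral_Im [OF a_int] by simp
  qed
  moreover have "Re (of_real (k0\<^sup>2) * (LINT y|?M. b y)) > 0"
  proof -
    have b_ge: "AE y in ?M. (cmod (u y))\<^sup>2 \<le> Re (b y)"
      using b_eq
    proof (rule eventually_mono)
      fix y assume "b y = S y * of_real ((cmod (u y))\<^sup>2)"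
      then have "Re (b y) = Re (S y) * (cmod (u y))\<^sup>2" by simp
      then show "(cmod (u y))\<^sup>2 \<le> Re (b y)"
        using mult_right_mono [OF ReS [of y], of "(cmod (u y))\<^sup>2"] by simp
    qed
    have u_int: "integrable ?M (\<lambda>y. (cmod (u y))\<^sup>2)" using L2 by (simp add: L2_per_def)
    have "(LINT y|?M. (cmod (u y))\<^sup>2) \<noteq> 0"
      using u_nz integral_nonneg_eq_0_iff_AE [OF u_int] by simp
    moreover have "(LINT y|?M. (cmod (u y))\<^sup>2) \<ge> 0" by simp
    ultimately have "0 < (LINT y|?M. (cmod (u y))\<^sup>2)" by linarith
    also have "\<dots> \<le> (LINT y|?M. Re (b y))"
      using b_ge b_int u_int by (intro integral_mono_AE) auto
    finally have "0 < Re (LINT y|?M. b y)" using integral_Re [OF b_int] by simp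
    then show ?thesis using k0 by simp
  qed
  moreover have "Im (of_real (k0\<^sup>2) * (LINT y|?M. b y)) \<ge> 0"
  proof -
    have "AE y in ?M. Im (b y) \<ge> 0"
      using b_eq by (rule eventually_mono) (use ImS in simp)
    then have "(LINT y|?M. Im (b y)) \<ge> 0" by (rule integral_nonneg_AE)
    then have "Im (LINT y|?M. b y) \<ge> 0" using integral_Im [OF b_int] by simp
    then show ?thesis by simp
  qed
  ultimately show ?thesis by (rule Im_ratio_nonneg)
qed simp

end
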